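(* Let $\varnothing\ne T\subset\mathbb{R}$ and let $(M,d)$ be a metric space. Let $\{f_j\}_{j=1}^\infty\subset M^T$ be a pointwise relatively compact sequence of functions on $T$ such that $$\limsup_{j\to\infty}V_\varepsilon(f_j,T)<\infty\quad\text{for all }\varepsilon>0.$$ Then there is a subsequence of $\{f_j\}$ which converges pointwise on $T$ to a bounded regulated function $f\in M^T$. In addition, if $(M,d)$ is proper, then $V_\varepsilon(f,T)\le\limsup_{j\to\infty}V_\varepsilon(f_j,T)$ for all $\varepsilon>0$.
   Context: $M^T$ is the set of all functions $f:T\to M$. For $f,g\in M^T$ put $d_{\infty,T}(f,g)=\sup_{t\in T}d(f(t),g(t))\in[0,\infty]$. The (Jordan) variation of $g\in M^T$ is $V(g,T)=\sup\sum_{i=1}^m d(g(t_i),g(t_{i-1}))\in[0,\infty]$, the supremum being over all $m\in\mathbb{N}$ and all $t_0\le t_1\le\dots\le t_m$ in $T$; $\mathrm{BV}(T;M)=\{g\in M^T:V(g,T)<\infty\}$. For $\varepsilon>0$, the $\varepsilon$-variation of $f\in M^T$ is $$V_\varepsilon(f,T)=\inf\{V(g,T):g\in\mathrm{BV}(T;M),\ d_{\infty,T}(f,g)\le\varepsilon\}\in[0,\infty],\qquad \inf\varnothing=\infty.$$ A sequence $\{f_j\}\subset M^T$ is pointwise relatively compact on $T$ if for every $t\in T$ the closure in $M$ of $\{f_j(t):j\in\mathbb{N}\}$ is compact. A function $f\in M^T$ is bounded if $\sup_{s,t\in T}d(f(s),f(t))<\infty$. It is regulated on $T$ if: for each $\tau\in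 T$ that is a left limit point of $T$ (i.e. $T\cap(\tau-\delta,\tau)\ne\varnothing$ for all $\delta>0$), $d(f(s),f(t))\to0$ as $T\ni s,t\to\tau-0$ (from the left); and for each $\tau'\in T$ that is a right limit point of $T$ (i.e. $T\cap(\tau',\tau'+\delta)\ne\varnothing$ for all $\delta>0$), $d(f(s),f(t))\to0$ as $T\ni s,t\to\tau'+0$ (from the right). A metric space is proper if all of its closed bounded subsets are compact. *)

theory Defs
  imports "HOL-Analysis.Analysis"
begin

text \<open>
  A function from \<open>T\<close> to \<open>M\<close> is represented by a total function on the reals; the notions
  below only inspect its values on \<open>T\<close>. Suprema and infima are taken in \<^typ>\<open>ennreal\<close>,
  so that the infimum of the empty set is \<open>\<infinity>\<close>.
\<close>

definition dist_sup :: "real set \<Rightarrow> (real \<Rightarrow> 'a::metric_space) \<Rightarrow> (real \<Rightarrow> 'a) \<Rightarrow> ennreal"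
  where "dist_sup T f g = (SUP t\<in>T. ennreal (dist (f t) (g t)))"

definition variation :: "(real \<Rightarrow> 'a::metric_space) \<Rightarrow> real set \<Rightarrow> ennreal"
  where "variation g T =
    Sup {(\<Sum>i = 1..m. ennreal (dist (g (t i)) (g (t (i - 1))))) | (m::nat) (t :: nat \<Rightarrow> real).
           1 \<le> m \<and> (\<forall>i\<le>m. t i \<in> T) \<and> (\<forall>i\<in>{1..m}. t (i - 1) \<le> t i)}"

definition BV :: "real set \<Rightarrow> (real \<Rightarrow> 'a::metric_space) set"
  where "BV T = {g. variation g T < \<infinity>}"

definition eps_variation :: "real \<Rightarrow> (real \<Rightarrow> 'a::metric_space) \<Rightarrow> real set \<Rightarrow> ennreal"
  where "eps_variation \<epsilon> f T =
    Inf {variation g T | g. g \<in> BV T \<and> dist_sup T f g \<le> ennreal \<epsilon>}"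

definition pointwise_relatively_compact ::
  "real set \<Rightarrow> (nat \<Rightarrow> real \<Rightarrow> 'a::metric_space) \<Rightarrow> bool"
  where "pointwise_relatively_compact T f \<longleftrightarrow>
    (\<forall>t\<in>T. compact (closure (range (\<lambda>j. f j t))))"

definition left_limit_point :: "real \<Rightarrow> real set \<Rightarrow> bool"
  where "left_limit_point \<tau> T \<longleftrightarrow> (\<forall>\<delta>>0. T \<inter> {\<tau> - \<delta><..<\<tau>} \<noteq> {})"

definition right_limit_point :: "real \<Rightarrow> real set \<Rightarrow> bool"
  where "right_limit_point \<tau> T \<longleftrightarrow> (\<forall>\<delta>>0. T \<inter> {\<tau><..<\<tau> + \<delta>} \<noteq> {})"

text \<open>The product filters let both \<open>s\<close> and \<open>t\<close> approach \<open>\<tau>\<close> independently within \<open>T\<close>.\<close>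

definition regulated_on :: "real set \<Rightarrow> (real \<Rightarrow> 'a::metric_space) \<Rightarrow> bool"
  where "regulated_on T f \<longleftrightarrow>
    (\<forall>\<tau>\<in>T. left_limit_point \<tau> T \<longrightarrow>
       ((\<lambda>(s, t). dist (f s) (f t)) \<longlongrightarrow> 0)
         ((at \<tau> within (T \<inter> {..<\<tau>})) \<times>\<^sub>F (at \<tau> within (T \<inter> {..<\<tau>})))) \<and>
    (\<forall>\<tau>\<in>T. right_limit_point \<tau> T \<longrightarrow>
       ((\<lambda>(s, t). dist (f s) (f t)) \<longlongrightarrow> 0)
         ((at \<tau> within (T \<inter> {\<tau><..})) \<times>\<^sub>F (at \<tau> within (T \<inter> {\<tau><..}))))"

end

theory Submission
  imports Defs "HOL-Library.Diagonal_Subsequence"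
begin

text \<open>
  The finiteness of the limit superior says that, for every accuracy \<open>\<epsilon>\<close>, all late \<open>f\<^sub>j\<close> are
  \<open>\<epsilon>\<close>-close to functions \<open>h\<^sub>j\<close> whose variations are bounded by a constant depending on \<open>\<epsilon>\<close>
  only. The running variation \<open>\<phi>\<^sub>j(x) = V(h\<^sub>j, T \<inter> (-\<infinity>, x])\<close> is then a uniformly bounded monotone
  function on the whole real line, and it controls the oscillation of \<open>f\<^sub>j\<close>:
  \<open>d(f\<^sub>j(s), f\<^sub>j(t)) \<le> 2\<epsilon> + \<bar>\<phi>\<^sub>j(t) - \<phi>\<^sub>j(s)\<bar>\<close>. The selection problem in a metric space thus
  reduces to Helly's theorem for real monotone functions, applied simultaneously for
  countably many accuracies tending to \<open>0\<close> (\<open>Helly_monotone_family\<close>).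

  Along a subsequence all the \<open>\<phi>\<^sub>j\<close> converge everywhere, to monotone functions \<open>\<Phi>\<close> with
  countably many discontinuities altogether. A diagonal argument makes \<open>f\<^sub>j\<close> converge at these
  discontinuities and on a countable dense subset of \<open>T\<close>. At any other point every \<open>\<Phi>\<close>
  is continuous, so the oscillation estimate carries the Cauchy property over from
  nearby points of the dense set, and compactness turns it into convergence
  (\<open>oscillation_selection\<close>). The limit \<open>g\<close> inherits the estimate
  \<open>d(g(s), g(t)) \<le> 2\<epsilon> + \<bar>\<Phi>(t) - \<Phi>(s)\<bar>\<close> for every accuracy. So \<open>g\<close> is bounded because
  \<open>\<Phi>\<close> is, and regulated because a bounded monotone function has one-sided limits
  (\<open>regulated_on_if_monotone_oscillation\<close>).

  In a proper space, functions that are \<open>\<epsilon>\<close>-close to the convergent \<open>f\<^sub>j\<close> are again pointwise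
  relatively compact. If their variations are at most \<open>c\<close>, the same selection
  theorem yields a pointwise limit \<open>h\<close> of a subsequence of them; it is \<open>\<epsilon>\<close>-close to \<open>g\<close>, and
  \<open>V(h, T) \<le> c\<close> by lower semicontinuity of the variation (\<open>eps_variation_le_limsup\<close>).
\<close>

section \<open>Diagonal selection and Helly's theorem\<close>

lemma countable_diagonal_convergent_subsequence:
  fixes F :: "nat \<Rightarrow> 'i \<Rightarrow> 'b::metric_space"
  assumes "countable I"
    and compact: "\<And>i. i \<in> I \<Longrightarrow> compact (closure (range (\<lambda>j. F j i)))"
  obtains r :: "nat \<Rightarrow> nat" where "strict_mono r" "\<And>i. i \<in> I \<Longrightarrow> convergent (\<lambda>k. F (r k) i)"
proof (cases "I = {}")
  case True
  show ?thesis using that[of id] True by (simp add: strict_mono_id)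
next
  case False
  define P where "P = (\<lambda>n r. convergent (\<lambda>k. F (r k) (from_nat_into I n)))"
  interpret subseqs P
  proof
    fix n and s :: "nat \<Rightarrow> nat"
    let ?i = "from_nat_into I n"
    have "seq_compact (closure (range (\<lambda>j. F j ?i)))"
      using compact[OF from_nat_into[OF False, of n]] by (rule compact_imp_seq_compact)
    moreover have "\<forall>k. F (s k) ?i \<in> closure (range (\<lambda>j. F j ?i))"
      by (intro allI subsetD[OF closure_subset] rangeI)
    ultimately obtain l r where "strict_mono (r::nat \<Rightarrow> nat)" "((\<lambda>k. F (s k) ?i) \<circ> r) \<longlonglongrightarrow> l"
      by (rule seq_compactE)
    then show "\<exists>r'. strict_mono r' \<and> P n (s \<circ> r')"
      unfolding P_def convergent_def by (auto simp: o_def)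
  qed
  have conv: "convergent (\<lambda>k. F (diagseq k) i)" if "i \<in> I" for i
  proof -
    obtain n where n: "from_nat_into I n = i"
      using \<open>countable I\<close> \<open>i \<in> I\<close> from_nat_into_surj by metis
    have "P n (diagseq \<circ> ((+) (Suc n)))"
    proof (rule diagseq_holds)
      fix r s m assume "strict_mono (r::nat \<Rightarrow> nat)" "P m s"
      then show "P m (s \<circ> r)"
        unfolding P_def using convergent_subseq_convergent[of "\<lambda>k. F (s k) (from_nat_into I m)" r]
        by (simp add: o_def)
    qed
    then obtain l where "(\<lambda>k. F (diagseq (Suc n + k)) i) \<longlonglongrightarrow> l"
      unfolding P_def n convergent_def by (auto simp: o_def)
    then have "(\<lambda>k. F (diagseq (k + Suc n)) i) \<longlonglongrightarrow> l"
      by (simp add: add.commute)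
    then show ?thesis
      unfolding convergent_def using LIMSEQ_offset[where k = "Suc n" and f = "\<lambda>k. F (diagseq k) i"]
      by blast
  qed
  show ?thesis using that[OF subseq_diagseq conv] .
qed

lemma compact_closure_range_real:
  fixes u :: "nat \<Rightarrow> real"
  assumes "\<And>j. u j \<in> {a..b}"
  shows "compact (closure (range u))"
proof -
  have "bounded (range u)"
    using assms by (intro bounded_subset[OF bounded_closed_interval[of a b]]) auto
  then show ?thesis by simp
qed

text \<open>
  Convergence at the rationals determines a monotone function \<open>\<psi>\<close>; at its continuity points
  the values of a monotone function are squeezed between values at nearby rationals.
  The remaining points are countably many and are dealt with by a second diagonal sequence.
\<close>

lemma Helly_monotone_family:
  fixes \<phi> :: "nat \<Rightarrow> nat \<Rightarrow> real \<Rightarrow> real"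
  assumes mono: "\<And>n j. mono (\<phi> n j)" and range: "\<And>n j x. \<phi> n j x \<in> {0..C n}"
  obtains r :: "nat \<Rightarrow> nat"
  where "strict_mono r" "\<And>n x. convergent (\<lambda>k. \<phi> n (r k) x)"
proof -
  have "countable ((UNIV::nat set) \<times> (\<rat>::real set))"
    by (simp add: countable_rat)
  moreover have "compact (closure (range (\<lambda>j. (\<lambda>j (n, x). \<phi> n j x) j i)))"
    if "i \<in> UNIV \<times> \<rat>" for i :: "nat \<times> real"
    by (cases i) (auto simp del: compact_closure intro!: compact_closure_range_real range)
  ultimately obtain r1 :: "nat \<Rightarrow> nat" where r1: "strict_mono r1"
    and "\<And>i. i \<in> UNIV \<times> \<rat> \<Longrightarrow> convergent (\<lambda>k. (\<lambda>j (n, x). \<phi> n j x) (r1 k) i)"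
    using countable_diagonal_convergent_subsequence[of "UNIV \<times> \<rat>" "\<lambda>j (n, x). \<phi> n j x"] by metis
  then have conv1: "convergent (\<lambda>k. \<phi> n (r1 k) q)" if "q \<in> \<rat>" for n q
    using that by fastforce
  define L where "L n q = lim (\<lambda>k. \<phi> n (r1 k) q)" for n q
  have L: "(\<lambda>k. \<phi> n (r1 k) q) \<longlonglongrightarrow> L n q" if "q \<in> \<rat>" for n q
    unfolding L_def using conv1[OF that] convergent_LIMSEQ_iff by blast
  have L_le: "L n q \<le> C n" if "q \<in> \<rat>" for n q
    using LIMSEQ_le_const2[OF L[OF that]] range by (meson atLeastAtMost_iff)
  have L_mono: "L n p \<le> L n q" if "p \<in> \<rat>" "q \<in> \<rat>" "p \<le> q" for n p q
    using LIMSEQ_le[OF L[OF that(1)] L[OF that(2)]] monoD[OF mono that(3)] by blast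
  define \<psi> where "\<psi> n x = (SUP q\<in>{q\<in>\<rat>. q \<le> x}. L n q)" for n x
  have bdd: "bdd_above (L n ` {q \<in> \<rat>. q \<le> x})" for n x
    using L_le by (auto intro!: bdd_aboveI[of _ "C n"])
  have \<psi>_mono: "mono (\<psi> n)" for n
  proof
    fix x y :: real assume "x \<le> y"
    obtain q where "q \<in> \<rat>" "q < x" using Rats_dense_in_real[of "x - 1" x] by auto
    then have "{q \<in> \<rat>. q \<le> x} \<noteq> {}" by force
    then show "\<psi> n x \<le> \<psi> n y"
      unfolding \<psi>_def using bdd \<open>x \<le> y\<close> by (intro cSUP_subset_mono) auto
  qed
  have \<psi>_rat: "\<psi> n q = L n q" if "q \<in> \<rat>" for n q
    unfolding \<psi>_def using that L_mono by (intro cSup_eq_maximum) auto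
  define D where "D = (\<Union>n. {x. \<not> isCont (\<psi> n) x})"
  have "countable D"
    unfolding D_def using mono_ctble_discont[OF \<psi>_mono] by auto
  then have "countable ((UNIV::nat set) \<times> D)" by simp
  moreover have "compact (closure (range (\<lambda>j. (\<lambda>j (n, x). \<phi> n (r1 j) x) j i)))"
    if "i \<in> UNIV \<times> D" for i :: "nat \<times> real"
    by (cases i) (auto simp del: compact_closure intro!: compact_closure_range_real range)
  ultimately obtain r2 :: "nat \<Rightarrow> nat" where r2: "strict_mono r2"
    and "\<And>i. i \<in> UNIV \<times> D \<Longrightarrow> convergent (\<lambda>k. (\<lambda>j (n, x). \<phi> n (r1 j) x) (r2 k) i)"
    using countable_diagonal_convergent_subsequence[of "UNIV \<times> D" "\<lambda>j (n, x). \<phi> n (r1 j) x"] by metis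
  then have conv2: "convergent (\<lambda>k. \<phi> n (r1 (r2 k)) x)" if "x \<in> D" for n x
    using that by fastforce
  have "convergent (\<lambda>k. \<phi> n (r1 (r2 k)) x)" if "x \<notin> D" for n x
  proof -
    have "Cauchy (\<lambda>k. \<phi> n (r1 (r2 k)) x)"
    proof (rule metric_CauchyI)
      fix e :: real assume "e > 0"
      have "isCont (\<psi> n) x" using that by (auto simp: D_def)
      then obtain d where "d > 0" and d: "\<And>y. dist y x < d \<Longrightarrow> dist (\<psi> n y) (\<psi> n x) < e / 4"
        using \<open>e > 0\<close> unfolding continuous_at_eps_delta by (elim allE[of _ "e / 4"]) auto
      obtain a b where ab: "a \<in> \<rat>" "x - d < a" "a < x" "b \<in> \<rat>" "x < b" "b < x + d"
        using Rats_dense_in_real[of "x - d" x] Rats_dense_in_real[of x "x + d"] \<open>d > 0\<close> by auto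
      have "dist (L n a) (\<psi> n x) < e / 4" "dist (L n b) (\<psi> n x) < e / 4"
        using d[of a] d[of b] ab by (auto simp: dist_real_def \<psi>_rat)
      then have close: "L n b - L n a < e / 2" unfolding dist_real_def by linarith
      have lim2: "(\<lambda>k. \<phi> n (r1 (r2 k)) q) \<longlonglongrightarrow> L n q" if "q \<in> \<rat>" for q
        using LIMSEQ_subseq_LIMSEQ[OF L[OF that] r2] by (simp add: o_def)
      have "\<forall>\<^sub>F k in sequentially. dist (\<phi> n (r1 (r2 k)) a) (L n a) < e / 4 \<and>
              dist (\<phi> n (r1 (r2 k)) b) (L n b) < e / 4"
        using tendstoD[OF lim2[OF ab(1)], of "e / 4"] tendstoD[OF lim2[OF ab(4)], of "e / 4"] \<open>e > 0\<close>
        by (auto intro: eventually_conj)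
      then obtain N where N: "\<And>k. k \<ge> N \<Longrightarrow> dist (\<phi> n (r1 (r2 k)) a) (L n a) < e / 4 \<and>
              dist (\<phi> n (r1 (r2 k)) b) (L n b) < e / 4"
        unfolding eventually_sequentially by blast
      have between: "\<phi> n (r1 (r2 k)) x \<in> {L n a - e / 4 <..< L n b + e / 4}" if "k \<ge> N" for k
        using N[OF that] monoD[OF mono[of n "r1 (r2 k)"], of a x]
          monoD[OF mono[of n "r1 (r2 k)"], of x b] ab
        unfolding dist_real_def greaterThanLessThan_iff by linarith
      have "dist (\<phi> n (r1 (r2 k)) x) (\<phi> n (r1 (r2 l)) x) < e" if "k \<ge> N" "l \<ge> N" for k l
        using between[OF that(1)] between[OF that(2)] close
        unfolding dist_real_def greaterThanLessThan_iff by linarith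
      then show "\<exists>M. \<forall>k\<ge>M. \<forall>l\<ge>M. dist (\<phi> n (r1 (r2 k)) x) (\<phi> n (r1 (r2 l)) x) < e"
        by blast
    qed
    then show ?thesis by (simp add: Cauchy_convergent_iff)
  qed
  with conv2 have "convergent (\<lambda>k. \<phi> n ((r1 \<circ> r2) k) x)" for n x
    by (cases "x \<in> D") auto
  then show ?thesis using that[of "r1 \<circ> r2"] r1 r2 by (simp add: strict_mono_o)
qed

section \<open>Selection for functions with monotonically controlled oscillation\<close>

text \<open>
  The index \<open>n\<close> is the level of accuracy: at level \<open>n\<close> the oscillation of \<open>f j\<close> is
  that of a monotone function up to the error \<open>\<epsilon> n\<close>. Only late members of the sequence
  need to satisfy the estimate of a given level.
\<close>

lemma oscillation_selection:
  fixes f :: "nat \<Rightarrow> real \<Rightarrow> 'a::metric_space" and \<phi> :: "nat \<Rightarrow> nat \<Rightarrow> real \<Rightarrow> real"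
  assumes compact: "pointwise_relatively_compact T f"
    and mono: "\<And>n j. mono (\<phi> n j)" and range: "\<And>n j x. \<phi> n j x \<in> {0..C n}"
    and osc: "\<And>n. \<forall>\<^sub>F j in sequentially. \<forall>s\<in>T. \<forall>t\<in>T.
                dist (f j s) (f j t) \<le> \<epsilon> n + \<bar>\<phi> n j t - \<phi> n j s\<bar>"
    and \<epsilon>: "\<epsilon> \<longlonglongrightarrow> 0"
  obtains r :: "nat \<Rightarrow> nat" and g :: "real \<Rightarrow> 'a" and \<Phi> :: "nat \<Rightarrow> real \<Rightarrow> real"
  where "strict_mono r" "\<And>t. t \<in> T \<Longrightarrow> (\<lambda>k. f (r k) t) \<longlonglongrightarrow> g t"
    "\<And>n. mono (\<Phi> n)" "\<And>n x. \<Phi> n x \<in> {0..C n}"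
    "\<And>n s t. s \<in> T \<Longrightarrow> t \<in> T \<Longrightarrow> dist (g s) (g t) \<le> \<epsilon> n + \<bar>\<Phi> n t - \<Phi> n s\<bar>"
proof -
  obtain r1 :: "nat \<Rightarrow> nat" where r1: "strict_mono r1"
    and conv1: "\<And>n x. convergent (\<lambda>k. \<phi> n (r1 k) x)"
    using Helly_monotone_family[of \<phi> C] mono range by blast
  define \<Phi> where "\<Phi> n x = lim (\<lambda>k. \<phi> n (r1 k) x)" for n x
  have \<Phi>: "(\<lambda>k. \<phi> n (r1 k) x) \<longlonglongrightarrow> \<Phi> n x" for n x
    unfolding \<Phi>_def using conv1 convergent_LIMSEQ_iff by blast
  have \<Phi>_mono: "mono (\<Phi> n)" for n
    by (intro monoI LIMSEQ_le[OF \<Phi> \<Phi>]) (auto intro: monoD[OF mono])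
  have \<Phi>_range: "\<Phi> n x \<in> {0..C n}" for n x
    using LIMSEQ_le_const2[OF \<Phi>[of n x], of "C n"] LIMSEQ_le_const[OF \<Phi>[of n x], of 0]
      range[of n _ x] by auto
  define D where "D = (\<Union>n. {x. \<not> isCont (\<Phi> n) x})"
  have "countable D"
    unfolding D_def using mono_ctble_discont[OF \<Phi>_mono] by auto
  obtain Q where Q: "countable Q" "Q \<subseteq> T" "T \<subseteq> closure Q"
    using separable[of T] by blast
  have "countable (Q \<union> D \<inter> T)" using Q \<open>countable D\<close> by auto
  moreover have "compact (closure (range (\<lambda>j. f (r1 j) t)))" if "t \<in> Q \<union> D \<inter> T" for t
  proof -
    have "closure (range (\<lambda>j. f (r1 j) t)) \<subseteq> closure (range (\<lambda>j. f j t))"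
      by (intro closure_mono) auto
    moreover have "compact (closure (range (\<lambda>j. f j t)))"
      using that Q(2) compact unfolding pointwise_relatively_compact_def by auto
    then have "compact (closure (range (\<lambda>j. f j t)) \<inter> closure (range (\<lambda>j. f (r1 j) t)))"
      by (rule compact_Int_closed[OF _ closed_closure])
    ultimately show ?thesis by (simp only: Int_absorb1)
  qed
  ultimately obtain r2 :: "nat \<Rightarrow> nat" where r2: "strict_mono r2"
    and conv2: "\<And>t. t \<in> Q \<union> D \<inter> T \<Longrightarrow> convergent (\<lambda>k. f (r1 (r2 k)) t)"
    using countable_diagonal_convergent_subsequence[of "Q \<union> D \<inter> T" "\<lambda>j. f (r1 j)"] by metis
  define r where "r = r1 \<circ> r2"
  have r: "strict_mono r" unfolding r_def using r1 r2 by (rule strict_mono_o)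
  have \<Phi>_r: "(\<lambda>k. \<phi> n (r k) x) \<longlonglongrightarrow> \<Phi> n x" for n x
    using LIMSEQ_subseq_LIMSEQ[OF \<Phi> r2] by (simp add: o_def r_def)
  have osc_r: "\<forall>\<^sub>F k in sequentially. \<forall>s\<in>T. \<forall>t\<in>T.
      dist (f (r k) s) (f (r k) t) \<le> \<epsilon> n + \<bar>\<phi> n (r k) t - \<phi> n (r k) s\<bar>" for n
    using eventually_subseq[OF r osc[of n]] .
  have "convergent (\<lambda>k. f (r k) t)" if "t \<in> T" for t
  proof (cases "t \<in> Q \<union> D \<inter> T")
    case True
    then show ?thesis using conv2 by (simp add: r_def)
  next
    case False
    have "Cauchy (\<lambda>k. f (r k) t)"
    proof (rule metric_CauchyI)
      fix e :: real assume "e > 0"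
      then obtain n where n: "\<epsilon> n < e / 8"
        using order_tendstoD(2)[OF \<epsilon>, of "e / 8"] eventually_happens[of _ sequentially] by auto
      have "isCont (\<Phi> n) t" using False that by (auto simp: D_def)
      then obtain d where "d > 0" and d: "\<And>y. dist y t < d \<Longrightarrow> dist (\<Phi> n y) (\<Phi> n t) < e / 8"
        using \<open>e > 0\<close> unfolding continuous_at_eps_delta by (elim allE[of _ "e / 8"]) auto
      have "t \<in> closure Q" using Q(3) that by blast
      then obtain q where q: "q \<in> Q" "dist q t < d"
        using \<open>d > 0\<close> unfolding closure_approachable by blast
      \<comment> \<open>The point \<open>t\<close> costs \<open>e / 8\<close> for the accuracy, \<open>e / 8\<close> for moving \<open>\<Phi> n\<close> from \<open>t\<close> to \<open>q\<close> and
        twice \<open>e / 16\<close> for replacing \<open>\<phi> n\<close> by its limit; this is paid at both ends.\<close>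
      have near: "dist (\<Phi> n q) (\<Phi> n t) < e / 8" using d q by blast
      have "convergent (\<lambda>k. f (r k) q)" using conv2 q by (simp add: r_def)
      then have "Cauchy (\<lambda>k. f (r k) q)" by (rule convergent_Cauchy)
      then obtain N0 where N0: "\<And>k l. k \<ge> N0 \<Longrightarrow> l \<ge> N0 \<Longrightarrow> dist (f (r k) q) (f (r l) q) < e / 4"
        using \<open>e > 0\<close> unfolding Cauchy_def by (elim allE[of _ "e / 4"]) auto
      have "\<forall>\<^sub>F k in sequentially. dist (\<phi> n (r k) x) (\<Phi> n x) < e / 16" for x
        using \<open>e > 0\<close> by (intro tendstoD[OF \<Phi>_r]) auto
      moreover have "\<forall>\<^sub>F k in sequentially.
          dist (f (r k) t) (f (r k) q) \<le> \<epsilon> n + \<bar>\<phi> n (r k) q - \<phi> n (r k) t\<bar>"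
        using osc_r[of n] by (rule eventually_mono) (use that q(1) Q(2) in auto)
      ultimately have "\<forall>\<^sub>F k in sequentially. dist (\<phi> n (r k) t) (\<Phi> n t) < e / 16 \<and>
              dist (\<phi> n (r k) q) (\<Phi> n q) < e / 16 \<and>
              dist (f (r k) t) (f (r k) q) \<le> \<epsilon> n + \<bar>\<phi> n (r k) q - \<phi> n (r k) t\<bar>"
        by (intro eventually_conj)
      then obtain N1 where N1: "\<And>k. k \<ge> N1 \<Longrightarrow> dist (\<phi> n (r k) t) (\<Phi> n t) < e / 16 \<and>
              dist (\<phi> n (r k) q) (\<Phi> n q) < e / 16 \<and>
              dist (f (r k) t) (f (r k) q) \<le> \<epsilon> n + \<bar>\<phi> n (r k) q - \<phi> n (r k) t\<bar>"
        unfolding eventually_sequentially by blast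
      have tq: "dist (f (r k) t) (f (r k) q) < 3 * e / 8" if "k \<ge> N1" for k
        using N1[OF that] near n by (auto simp: dist_real_def abs_if split: if_splits)
      have "dist (f (r k) t) (f (r l) t) < e" if "k \<ge> max N0 N1" "l \<ge> max N0 N1" for k l
      proof -
        have "dist (f (r k) t) (f (r l) t)
            \<le> dist (f (r k) t) (f (r k) q) + dist (f (r k) q) (f (r l) q) + dist (f (r l) t) (f (r l) q)"
          by (smt (verit) dist_triangle dist_commute)
        then show ?thesis using tq[of k] tq[of l] N0[of k l] that by simp
      qed
      then show "\<exists>M. \<forall>k\<ge>M. \<forall>l\<ge>M. dist (f (r k) t) (f (r l) t) < e" by blast
    qed
    moreover have "complete (closure (range (\<lambda>j. f j t)))"
      using compact that unfolding pointwise_relatively_compact_def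
      by (intro compact_imp_complete) auto
    moreover have "\<forall>k. f (r k) t \<in> closure (range (\<lambda>j. f j t))"
      by (intro allI subsetD[OF closure_subset] rangeI)
    ultimately obtain l where "(\<lambda>k. f (r k) t) \<longlonglongrightarrow> l"
      by (auto elim: completeE)
    then show ?thesis by (rule convergentI)
  qed
  then have g: "(\<lambda>k. f (r k) t) \<longlonglongrightarrow> lim (\<lambda>k. f (r k) t)" if "t \<in> T" for t
    using that convergent_LIMSEQ_iff by blast
  have "dist (lim (\<lambda>k. f (r k) s)) (lim (\<lambda>k. f (r k) t)) \<le> \<epsilon> n + \<bar>\<Phi> n t - \<Phi> n s\<bar>"
    if "s \<in> T" "t \<in> T" for n s t
  proof (rule tendsto_le)
    show "(\<lambda>k. dist (f (r k) s) (f (r k) t)) \<longlonglongrightarrow> dist (lim (\<lambda>k. f (r k) s)) (lim (\<lambda>k. f (r k) t))"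
      by (intro tendsto_dist g that)
    show "(\<lambda>k. \<epsilon> n + \<bar>\<phi> n (r k) t - \<phi> n (r k) s\<bar>) \<longlonglongrightarrow> \<epsilon> n + \<bar>\<Phi> n t - \<Phi> n s\<bar>"
      by (intro tendsto_intros \<Phi>_r)
    show "\<forall>\<^sub>F k in sequentially. dist (f (r k) s) (f (r k) t) \<le> \<epsilon> n + \<bar>\<phi> n (r k) t - \<phi> n (r k) s\<bar>"
      using osc_r[of n] by eventually_elim (use that in blast)
  qed simp
  then show ?thesis using that[OF r g \<Phi>_mono \<Phi>_range] by blast
qed

section \<open>Jordan variation\<close>

lemma sum_le_variation:
  fixes t :: "nat \<Rightarrow> real"
  assumes "1 \<le> m" "\<And>i. i \<le> m \<Longrightarrow> t i \<in> S" "\<And>i. i \<in> {1..m} \<Longrightarrow> t (i - 1) \<le> t i"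
  shows "(\<Sum>i = 1..m. ennreal (dist (g (t i)) (g (t (i - 1))))) \<le> variation g S"
  unfolding variation_def using assms by (intro Sup_upper CollectI exI conjI) auto

lemma variation_le:
  assumes "\<And>(m::nat) (t::nat \<Rightarrow> real). 1 \<le> m \<Longrightarrow> (\<And>i. i \<le> m \<Longrightarrow> t i \<in> S) \<Longrightarrow> (\<And>i. i \<in> {1..m} \<Longrightarrow> t (i - 1) \<le> t i) \<Longrightarrow>
      (\<Sum>i = 1..m. ennreal (dist (g (t i)) (g (t (i - 1))))) \<le> c"
  shows "variation g S \<le> c"
  unfolding variation_def by (intro Sup_least) (elim CollectE exE conjE, simp only:, rule assms, auto)

lemma variation_mono:
  assumes "A \<subseteq> B"
  shows "variation g A \<le> variation g B"
  using assms by (intro variation_le sum_le_variation) auto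

lemma dist_le_variation:
  assumes "s \<in> S" "t \<in> S" "s \<le> t"
  shows "ennreal (dist (g s) (g t)) \<le> variation g S"
proof -
  have "(\<Sum>i = 1..1::nat. ennreal (dist (g (if i = 0 then s else t)) (g (if i - 1 = 0 then s else t))))
      \<le> variation g S"
    using assms by (intro sum_le_variation) auto
  then show ?thesis by (simp add: dist_commute)
qed

text \<open>
  Any chain in \<open>T \<inter> {..s}\<close> can be prolonged by the two points \<open>s\<close> and \<open>t\<close>; the last
  step contributes the distance of the values there.
\<close>

lemma variation_add_dist_le:
  assumes st: "s \<in> T" "t \<in> T" "s \<le> t"
  shows "variation g (T \<inter> {..s}) + ennreal (dist (g s) (g t)) \<le> variation g (T \<inter> {..t})"
proof -
  let ?d = "ennreal (dist (g s) (g t))"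
  have "variation g (T \<inter> {..s}) \<le> variation g (T \<inter> {..t}) - ?d"
  proof (rule variation_le)
    fix m :: nat and u :: "nat \<Rightarrow> real"
    assume m: "1 \<le> m" and u: "\<And>i. i \<le> m \<Longrightarrow> u i \<in> T \<inter> {..s}"
      and inc: "\<And>i. i \<in> {1..m} \<Longrightarrow> u (i - 1) \<le> u i"
    define v where "v i = (if i \<le> m then u i else if i = Suc m then s else t)" for i
    have "(\<Sum>i = 1..m. ennreal (dist (g (u i)) (g (u (i - 1)))))
        = (\<Sum>i = 1..m. ennreal (dist (g (v i)) (g (v (i - 1)))))"
      by (intro sum.cong) (auto simp: v_def)
    also have "\<dots> + ?d \<le> (\<Sum>i = 1..Suc (Suc m). ennreal (dist (g (v i)) (g (v (i - 1)))))"
      by (simp add: v_def dist_commute add_right_mono)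
    also have "\<dots> \<le> variation g (T \<inter> {..t})"
    proof (rule sum_le_variation)
      show "v i \<in> T \<inter> {..t}" if "i \<le> Suc (Suc m)" for i
        using u[of i] st by (auto simp: v_def)
      show "v (i - 1) \<le> v i" if "i \<in> {1..Suc (Suc m)}" for i
        using inc[of i] u[of m] st that by (auto simp: v_def not_le le_Suc_eq)
    qed simp
    finally show "(\<Sum>i = 1..m. ennreal (dist (g (u i)) (g (u (i - 1))))) \<le> variation g (T \<inter> {..t}) - ?d"
      by (simp add: ennreal_le_minus_iff)
  qed
  moreover have "?d \<le> variation g (T \<inter> {..t})"
    using st by (intro dist_le_variation) auto
  ultimately show ?thesis
    by (metis add_right_mono diff_add_cancel_ennreal)
qed

lemma variation_lower_semicontinuous:
  fixes h :: "nat \<Rightarrow> real \<Rightarrow> 'a::metric_space"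
  assumes lim: "\<And>t. t \<in> T \<Longrightarrow> (\<lambda>k. h k t) \<longlonglongrightarrow> g t" and le: "\<And>k. variation (h k) T \<le> c"
  shows "variation g T \<le> c"
proof (rule variation_le)
  fix m :: nat and t :: "nat \<Rightarrow> real"
  assume t: "1 \<le> m" "\<And>i. i \<le> m \<Longrightarrow> t i \<in> T" "\<And>i. i \<in> {1..m} \<Longrightarrow> t (i - 1) \<le> t i"
  have "(\<lambda>k. \<Sum>i = 1..m. ennreal (dist (h k (t i)) (h k (t (i - 1)))))
      \<longlonglongrightarrow> (\<Sum>i = 1..m. ennreal (dist (g (t i)) (g (t (i - 1)))))"
    using t(2) by (intro tendsto_sum tendsto_ennrealI tendsto_dist lim) auto
  moreover have "(\<Sum>i = 1..m. ennreal (dist (h k (t i)) (h k (t (i - 1))))) \<le> c" for k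
    using sum_le_variation[of m t T "h k"] t le[of k] by (meson order_trans)
  ultimately show "(\<Sum>i = 1..m. ennreal (dist (g (t i)) (g (t (i - 1))))) \<le> c"
    by (intro LIMSEQ_le_const2) auto
qed

section \<open>Approximants and their running variation\<close>

lemma dist_le_dist_sup:
  assumes "dist_sup T f g \<le> ennreal e" "e \<ge> 0" "t \<in> T"
  shows "dist (f t) (g t) \<le> e"
proof -
  have "ennreal (dist (f t) (g t)) \<le> dist_sup T f g"
    unfolding dist_sup_def using assms(3) by (rule SUP_upper)
  with assms(1,2) show ?thesis by (metis ennreal_le_iff order_trans)
qed

lemma eps_variation_less_approximant:
  assumes "eps_variation e f T < c"
  obtains h where "h \<in> BV T" "variation h T < c" "dist_sup T f h \<le> ennreal e"
  using assms unfolding eps_variation_def Inf_less_iff by blast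

lemma eps_variation_le_variation:
  assumes "e \<ge> 0"
  shows "eps_variation e g T \<le> variation g T"
proof (cases "variation g T < \<infinity>")
  case True
  moreover have "dist_sup T g g \<le> ennreal e"
    by (simp add: dist_sup_def SUP_le_iff)
  ultimately show ?thesis
    unfolding eps_variation_def BV_def by (intro Inf_lower) blast
qed (simp add: less_top[symmetric])

text \<open>
  The variation on \<open>T \<inter> {..x}\<close> is used for every real \<open>x\<close>, not only for \<open>x\<close> in \<open>T\<close>. This extends the
  running variation to the whole line, where Helly's argument has rational points on
  both sides of every point, whatever the shape of \<open>T\<close>.
\<close>

lemma running_variation_bounds_oscillation:
  assumes fin: "variation h T < \<infinity>" and close: "dist_sup T f h \<le> ennreal e" and "e \<ge> 0"
    and st: "s \<in> T" "t \<in> T"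
  shows "dist (f s) (f t) \<le> 2 * e +
    \<bar>enn2real (variation h (T \<inter> {..t})) - enn2real (variation h (T \<inter> {..s}))\<bar>"
proof -
  let ?v = "\<lambda>x. enn2real (variation h (T \<inter> {..x}))"
  have fin': "variation h (T \<inter> {..x}) < top" for x
    using variation_mono[of "T \<inter> {..x}" T h] fin by auto
  have le: "dist (h x) (h y) \<le> ?v y - ?v x" if xy: "x \<in> T" "y \<in> T" "x \<le> y" for x y
  proof -
    have "ennreal (?v x + dist (h x) (h y)) \<le> ennreal (?v y)"
      using variation_add_dist_le[OF xy, of h] fin' by (simp add: ennreal_plus)
    then have "?v x + dist (h x) (h y) \<le> ?v y" by (subst (asm) ennreal_le_iff) auto
    then show ?thesis by linarith
  qed
  have "dist (h s) (h t) \<le> \<bar>?v t - ?v s\<bar>"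
    using le[OF st] le[OF st(2,1)] by (cases "s \<le> t") (auto simp: dist_commute)
  moreover have "dist (f s) (h s) \<le> e" "dist (f t) (h t) \<le> e"
    using dist_le_dist_sup[OF close \<open>e \<ge> 0\<close>] st by auto
  moreover have "dist (f s) (f t) \<le> dist (f s) (h s) + dist (h s) (h t) + dist (f t) (h t)"
    by (smt (verit) dist_triangle dist_commute)
  ultimately show ?thesis by linarith
qed

text \<open>
  The levels of accuracy are \<open>1 / (n + 1)\<close>. The monotone functions \<open>\<Phi> n\<close> are part of the
  conclusion because they carry all the regularity of the limit \<open>g\<close>.
\<close>

lemma eps_variation_selection:
  fixes f :: "nat \<Rightarrow> real \<Rightarrow> 'a::metric_space"
  assumes compact: "pointwise_relatively_compact T f"
    and limsup: "\<And>\<epsilon>::real. \<epsilon> > 0 \<Longrightarrow> limsup (\<lambda>j. eps_variation \<epsilon> (f j) T) < \<infinity>"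
  obtains r :: "nat \<Rightarrow> nat" and g :: "real \<Rightarrow> 'a" and \<Phi> :: "nat \<Rightarrow> real \<Rightarrow> real" and C :: "nat \<Rightarrow> real"
  where "strict_mono r" "\<And>t. t \<in> T \<Longrightarrow> (\<lambda>k. f (r k) t) \<longlonglongrightarrow> g t"
    "\<And>n. mono (\<Phi> n)" "\<And>n x. \<Phi> n x \<in> {0..C n}"
    "\<And>n s t. s \<in> T \<Longrightarrow> t \<in> T \<Longrightarrow> dist (g s) (g t) \<le> 2 * inverse (real (Suc n)) + \<bar>\<Phi> n t - \<Phi> n s\<bar>"
proof -
  define e where "e n = inverse (real (Suc n))" for n
  have e_pos: "e n > 0" for n by (simp add: e_def)
  have "\<exists>c\<ge>0. limsup (\<lambda>j. eps_variation (e n) (f j) T) < ennreal c" for n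
  proof -
    obtain c where "limsup (\<lambda>j. eps_variation (e n) (f j) T) < c" "c < top"
      using dense[OF limsup[OF e_pos[of n]]] by auto
    then show ?thesis unfolding less_top_ennreal by auto
  qed
  then obtain C where C: "\<And>n. C n \<ge> 0"
    and limsup_C: "\<And>n. limsup (\<lambda>j. eps_variation (e n) (f j) T) < ennreal (C n)"
    by metis
  define good where "good n j h \<longleftrightarrow> variation h T < ennreal (C n) \<and> dist_sup T (f j) h \<le> ennreal (e n)"
    for n j h
  define h where "h n j = (SOME h. good n j h)" for n j
  \<comment> \<open>An early \<open>f j\<close> may have no approximant; the junk value \<open>0\<close> keeps the bounds uniform.\<close>
  define \<phi> where "\<phi> n j x = (if Ex (good n j) then enn2real (variation (h n j) (T \<inter> {..x})) else 0)"
    for n j x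
  have good_h: "good n j (h n j)" if "Ex (good n j)" for n j
    unfolding h_def using that by (rule someI_ex)
  have less: "variation (h n j) (T \<inter> {..x}) < ennreal (C n)" if "Ex (good n j)" for n j x
    using good_h[OF that] variation_mono[of "T \<inter> {..x}" T "h n j"] unfolding good_def by auto
  have mono: "mono (\<phi> n j)" for n j
  proof
    fix x y :: real assume "x \<le> y"
    then have "variation (h n j) (T \<inter> {..x}) \<le> variation (h n j) (T \<inter> {..y})"
      by (intro variation_mono) auto
    then show "\<phi> n j x \<le> \<phi> n j y"
      unfolding \<phi>_def using less[of n j y] by (auto intro!: enn2real_mono intro: less_trans[OF _ ennreal_less_top])
  qed
  have range: "\<phi> n j x \<in> {0..C n}" for n j x
    using enn2real_mono[OF less_imp_le[OF less[of n j x]]] C[of n] by (auto simp: \<phi>_def)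
  have "\<forall>\<^sub>F j in sequentially. \<forall>s\<in>T. \<forall>t\<in>T. dist (f j s) (f j t) \<le> 2 * e n + \<bar>\<phi> n j t - \<phi> n j s\<bar>" for n
    using Limsup_lessD[OF limsup_C[of n]]
  proof eventually_elim
    case (elim j)
    then have ex: "Ex (good n j)"
      unfolding good_def by (meson eps_variation_less_approximant)
    from good_h[OF this] have "variation (h n j) T < \<infinity>" "dist_sup T (f j) (h n j) \<le> ennreal (e n)"
      unfolding good_def by (auto intro: less_trans[OF _ ennreal_less_top])
    from running_variation_bounds_oscillation[OF this] show ?case
      using ex e_pos[of n] by (simp add: \<phi>_def)
  qed
  moreover have "(\<lambda>n. 2 * e n) \<longlonglongrightarrow> 0"
    unfolding e_def using tendsto_mult_right_zero[OF LIMSEQ_inverse_real_of_nat] by blast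
  ultimately show ?thesis
    by (rule oscillation_selection[of T f \<phi> C "\<lambda>n. 2 * e n", OF compact mono range])
      (rule that, simp_all add: e_def)
qed

section \<open>Regularity of the limit\<close>

text \<open>
  Each \<open>\<Phi> n\<close> converges along the filter, so it is nearly constant there and \<open>g\<close> oscillates by
  little more than \<open>\<epsilon> n\<close>. For the two one-sided filters at a point this is what being
  regulated means.
\<close>

lemma Cauchy_along_filter:
  fixes g :: "real \<Rightarrow> 'a::metric_space"
  assumes T: "\<forall>\<^sub>F s in F. s \<in> T"
    and lim: "\<And>n. \<exists>l. (\<Phi> n \<longlongrightarrow> (l::real)) F"
    and osc: "\<And>n s t. s \<in> T \<Longrightarrow> t \<in> T \<Longrightarrow> dist (g s) (g t) \<le> \<epsilon> n + \<bar>\<Phi> n t - \<Phi> n s\<bar>"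
    and \<epsilon>: "\<epsilon> \<longlonglongrightarrow> (0::real)"
  shows "((\<lambda>(s, t). dist (g s) (g t)) \<longlongrightarrow> 0) (F \<times>\<^sub>F F)"
proof (rule tendstoI)
  fix e :: real assume "e > 0"
  then obtain n where n: "\<epsilon> n < e / 2"
    using order_tendstoD(2)[OF \<epsilon>, of "e / 2"] eventually_happens[of _ sequentially] by auto
  obtain l where "(\<Phi> n \<longlongrightarrow> l) F" using lim by blast
  then have "\<forall>\<^sub>F s in F. dist (\<Phi> n s) l < e / 4" using \<open>e > 0\<close> by (intro tendstoD) auto
  with T have ev: "\<forall>\<^sub>F s in F. s \<in> T \<and> dist (\<Phi> n s) l < e / 4" by (rule eventually_conj)
  have "\<forall>\<^sub>F p in F \<times>\<^sub>F F. (fst p \<in> T \<and> dist (\<Phi> n (fst p)) l < e / 4) \<and>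
      (snd p \<in> T \<and> dist (\<Phi> n (snd p)) l < e / 4)"
    using eventually_prodI[OF ev ev] .
  then show "\<forall>\<^sub>F p in F \<times>\<^sub>F F. dist (case p of (s, t) \<Rightarrow> dist (g s) (g t)) 0 < e"
  proof eventually_elim
    case (elim p)
    then show ?case
      using osc[of "fst p" "snd p" n] n
      by (cases p) (auto simp: dist_real_def abs_if split: if_splits)
  qed
qed

lemma regulated_on_if_monotone_oscillation:
  fixes g :: "real \<Rightarrow> 'a::metric_space" and \<Phi> :: "nat \<Rightarrow> real \<Rightarrow> real"
  assumes mono: "\<And>n. mono (\<Phi> n)" and range: "\<And>n x. \<Phi> n x \<in> {0..C n}"
    and osc: "\<And>n s t. s \<in> T \<Longrightarrow> t \<in> T \<Longrightarrow> dist (g s) (g t) \<le> \<epsilon> n + \<bar>\<Phi> n t - \<Phi> n s\<bar>"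
    and \<epsilon>: "\<epsilon> \<longlonglongrightarrow> 0"
  shows "regulated_on T g"
proof -
  have "(\<Phi> n \<longlongrightarrow> Sup (\<Phi> n ` ({..<\<tau>} \<inter> UNIV))) (at \<tau> within ({..<\<tau>} \<inter> UNIV))" for n \<tau>
    using mono[of n] range[of n] by (intro Lim_left_bound[where K = "C n"]) (auto dest: monoD)
  then have "(\<Phi> n \<longlongrightarrow> Sup (\<Phi> n ` {..<\<tau>})) (at \<tau> within (T \<inter> {..<\<tau>}))" for n \<tau>
    by (rule_tac tendsto_within_subset) auto
  then have "((\<lambda>(s, t). dist (g s) (g t)) \<longlongrightarrow> 0)
      ((at \<tau> within (T \<inter> {..<\<tau>})) \<times>\<^sub>F (at \<tau> within (T \<inter> {..<\<tau>})))" for \<tau>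
    by (intro Cauchy_along_filter[OF _ _ osc \<epsilon>]) (auto simp: eventually_at_filter)
  moreover have "(\<Phi> n \<longlongrightarrow> Inf (\<Phi> n ` ({\<tau><..} \<inter> UNIV))) (at \<tau> within ({\<tau><..} \<inter> UNIV))" for n \<tau>
    using mono[of n] range[of n] by (intro Lim_right_bound[where K = 0]) (auto dest: monoD)
  then have "(\<Phi> n \<longlongrightarrow> Inf (\<Phi> n ` {\<tau><..})) (at \<tau> within (T \<inter> {\<tau><..}))" for n \<tau>
    by (rule_tac tendsto_within_subset) auto
  then have "((\<lambda>(s, t). dist (g s) (g t)) \<longlongrightarrow> 0)
      ((at \<tau> within (T \<inter> {\<tau><..})) \<times>\<^sub>F (at \<tau> within (T \<inter> {\<tau><..})))" for \<tau>
    by (intro Cauchy_along_filter[OF _ _ osc \<epsilon>]) (auto simp: eventually_at_filter)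
  ultimately show ?thesis unfolding regulated_on_def by blast
qed

section \<open>Lower semicontinuity in proper spaces\<close>

text \<open>
  Approximants of \<open>f j\<close> with variation below a given \<open>c\<close> exist for all late \<open>j\<close>. Properness
  makes them pointwise relatively compact, so the selection theorem applies to them in turn.
\<close>

lemma eps_variation_le_limsup:
  fixes f :: "nat \<Rightarrow> real \<Rightarrow> 'a::metric_space"
  assumes proper: "\<And>S :: 'a set. closed S \<Longrightarrow> bounded S \<Longrightarrow> compact S"
    and lim: "\<And>t. t \<in> T \<Longrightarrow> (\<lambda>k. f k t) \<longlonglongrightarrow> g t"
    and "\<epsilon> > 0"
  shows "eps_variation \<epsilon> g T \<le> limsup (\<lambda>j. eps_variation \<epsilon> (f j) T)"
proof (rule dense_ge)
  fix c assume c: "limsup (\<lambda>j. eps_variation \<epsilon> (f j) T) < c"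
  show "eps_variation \<epsilon> g T \<le> c"
  proof (cases "c < \<infinity>")
    case True
    obtain N where N: "\<And>j. j \<ge> N \<Longrightarrow> eps_variation \<epsilon> (f j) T < c"
      using Limsup_lessD[OF c] unfolding eventually_sequentially by blast
    have "\<exists>h. variation h T < c \<and> dist_sup T (f (k + N)) h \<le> ennreal \<epsilon>" for k
      using eps_variation_less_approximant[OF N[of "k + N"]] by (metis le_add2)
    then obtain h where h: "\<And>k. variation (h k) T < c"
      and "\<And>k. dist_sup T (f (k + N)) (h k) \<le> ennreal \<epsilon>" by metis
    then have close: "dist (f (k + N) t) (h k t) \<le> \<epsilon>" if "t \<in> T" for k t
      using dist_le_dist_sup that \<open>\<epsilon> > 0\<close> by (metis less_imp_le)
    have lim_N: "(\<lambda>k. f (k + N) t) \<longlonglongrightarrow> g t" if "t \<in> T" for t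
      using LIMSEQ_ignore_initial_segment[OF lim[OF that]] .
    have "compact (closure (range (\<lambda>k. h k t)))" if "t \<in> T" for t
    proof -
      have "bounded (range (\<lambda>k. f (k + N) t))"
        using lim_N[OF that] convergent_imp_bounded by blast
      then obtain a B where B: "\<And>k. dist a (f (k + N) t) \<le> B"
        unfolding bounded_def by auto
      have "dist a (h k t) \<le> B + \<epsilon>" for k
        using B[of k] close[OF that, of k] dist_triangle[of a "h k t" "f (k + N) t"] by linarith
      then have "bounded (range (\<lambda>k. h k t))" unfolding bounded_def by blast
      then show ?thesis by (intro proper) auto
    qed
    then have "pointwise_relatively_compact T h"
      unfolding pointwise_relatively_compact_def by blast
    moreover have "limsup (\<lambda>k. eps_variation \<delta> (h k) T) < \<infinity>" if "\<delta> > 0" for \<delta>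
    proof -
      have "eps_variation \<delta> (h k) T \<le> c" for k
        using eps_variation_le_variation[of \<delta> "h k" T] h[of k] that by (meson less_imp_le order_trans)
      then have "limsup (\<lambda>k. eps_variation \<delta> (h k) T) \<le> c"
        by (intro Limsup_bounded always_eventually) blast
      then show ?thesis using True by (rule le_less_trans)
    qed
    ultimately obtain r h' where r: "strict_mono (r::nat \<Rightarrow> nat)"
      and h': "\<And>t. t \<in> T \<Longrightarrow> (\<lambda>k. h (r k) t) \<longlonglongrightarrow> h' t"
      by (rule eps_variation_selection) (assumption, rule that)
    have var: "variation h' T \<le> c"
      by (rule variation_lower_semicontinuous[OF h' less_imp_le[OF h]])
    have "dist (g t) (h' t) \<le> \<epsilon>" if "t \<in> T" for t
    proof (rule LIMSEQ_le_const2)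
      show "(\<lambda>k. dist (f (r k + N) t) (h (r k) t)) \<longlonglongrightarrow> dist (g t) (h' t)"
        using LIMSEQ_subseq_LIMSEQ[OF lim_N[OF that] r] h'[OF that]
        by (intro tendsto_dist) (auto simp: o_def)
    qed (use close that in blast)
    then have "dist_sup T g h' \<le> ennreal \<epsilon>"
      unfolding dist_sup_def by (intro SUP_least ennreal_leI)
    moreover have "h' \<in> BV T" unfolding BV_def using var True by auto
    ultimately have "eps_variation \<epsilon> g T \<le> variation h' T"
      unfolding eps_variation_def by (intro Inf_lower) blast
    with var show ?thesis by simp
  qed (simp add: less_top[symmetric])
qed

section \<open>The selection principle\<close>

theorem theorem4p1:
  fixes T :: "real set" and f :: "nat \<Rightarrow> real \<Rightarrow> 'a::metric_space"
  assumes "T \<noteq> {}"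
    and "pointwise_relatively_compact T f"
    and "\<And>\<epsilon>::real. \<epsilon> > 0 \<Longrightarrow> limsup (\<lambda>j. eps_variation \<epsilon> (f j) T) < \<infinity>"
  shows "\<exists>(r :: nat \<Rightarrow> nat) (g :: real \<Rightarrow> 'a).
           strict_mono r \<and>
           (\<forall>t\<in>T. (\<lambda>k. f (r k) t) \<longlonglongrightarrow> g t) \<and>
           bounded (g ` T) \<and> regulated_on T g \<and>
           ((\<forall>S :: 'a set. closed S \<and> bounded S \<longrightarrow> compact S) \<longrightarrow>
             (\<forall>\<epsilon>::real. \<epsilon> > 0 \<longrightarrow>
               eps_variation \<epsilon> g T \<le> limsup (\<lambda>j. eps_variation \<epsilon> (f j) T)))"
proof -
  obtain r g \<Phi> C where r: "strict_mono (r::nat \<Rightarrow> nat)"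
    and lim: "\<And>t. t \<in> T \<Longrightarrow> (\<lambda>k. f (r k) t) \<longlonglongrightarrow> g t"
    and mono: "\<And>n. mono (\<Phi> n)" and range: "\<And>n x. \<Phi> n x \<in> {0..C n}"
    and osc: "\<And>n s t. s \<in> T \<Longrightarrow> t \<in> T \<Longrightarrow>
      dist (g s) (g t) \<le> 2 * inverse (real (Suc n)) + \<bar>\<Phi> n t - \<Phi> n s\<bar>"
    by (rule eps_variation_selection[OF assms(2,3)]) (assumption, rule that)
  have "bounded (g ` T)"
  proof -
    obtain s where s: "s \<in> T" using \<open>T \<noteq> {}\<close> by blast
    have "dist (g s) (g t) \<le> 2 + C 0" if "t \<in> T" for t
      using osc[OF s that, of 0] range[of 0 s] range[of 0 t] by (simp add: abs_if split: if_splits)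
    then show ?thesis unfolding bounded_def by blast
  qed
  moreover have "regulated_on T g"
    using mono range osc
  proof (rule regulated_on_if_monotone_oscillation)
    show "(\<lambda>n. 2 * inverse (real (Suc n))) \<longlonglongrightarrow> 0"
      using tendsto_mult_right_zero[OF LIMSEQ_inverse_real_of_nat] .
  qed
  moreover have "eps_variation \<epsilon> g T \<le> limsup (\<lambda>j. eps_variation \<epsilon> (f j) T)"
    if "\<forall>S :: 'a set. closed S \<and> bounded S \<longrightarrow> compact S" "\<epsilon> > 0" for \<epsilon>
  proof -
    have "eps_variation \<epsilon> g T \<le> limsup (\<lambda>k. eps_variation \<epsilon> (f (r k)) T)"
      using that lim by (intro eps_variation_le_limsup) auto
    also have "\<dots> \<le> limsup (\<lambda>j. eps_variation \<epsilon> (f j) T)"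
      using limsup_subseq_mono[OF r, of "\<lambda>j. eps_variation \<epsilon> (f j) T"] by (simp add: o_def)
    finally show ?thesis .
  qed
  ultimately show ?thesis using r lim by blast
qed

end
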